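(* Assume $A_n$ satisfies (C1) and the mean field condition $\lim_{n\to\infty}\frac1n\sum_{i,j=1}^nA_n(i,j)^2=0$, and fix $(\beta,B)\in\Theta$. Let $\mathbf X\sim\mathbb P_{n,\beta,B}$. Then: (a) $f_n(b(\mathbf X))-I(b(\mathbf X))-r_n=o_p(n)$, i.e. $\frac1n\big(f_n(b(\mathbf X))-I(b(\mathbf X))-r_n\big)\to0$ in probability, where $r_n=\sup_{\mathbf y\in[-1,1]^n}\{f_n(\mathbf y)-I(\mathbf y)\}$; (b) $\|\nabla f_n(b(\mathbf X))-\nabla I(b(\mathbf X))\|=o_p(\sqrt n)$, i.e. $\frac{1}{\sqrt n}\|\nabla f_n(b(\mathbf X))-\nabla I(b(\mathbf X))\|\to0$ in probability.
   Context: For each $n$, $A_n$ is a known symmetric $n\times n$ matrix with non-negative entries and zero diagonal. The Ising model is $\mathbb P_{n,\beta,B}(\mathbf X=\mathbf x)=Z_n(\beta,B)^{-1}\exp(\frac{\beta}{2}\mathbf x^\top A_n\mathbf x+B\sum_i x_i)$ on $\{-1,1\}^n$. (C1): there is a constant $\gamma<\infty$ with $\max_{i}\sum_{j}A_n(i,j)\le\gamma$ for all $n$. $\Theta=\{(\beta,B):\beta>0,B\ne0\}$. For $\mathbf y\in[-1,1]^n$: $m_i(\mathbf y)=\sum_jA_n(i,j)y_j$, $b_i(\mathbf y)=\tanh(\beta m_i(\mathbf y)+B)$, $b(\mathbf y)=(b_1(\mathbf y),\dots,b_n(\mathbf y))$, $f_n(\mathbf y)=\frac\beta2\mathbf y^\top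 A_n\mathbf y+B\sum_iy_i$, and $I(\mathbf y)=\sum_{i=1}^n\big\{\frac{1+y_i}{2}\log\frac{1+y_i}{2}+\frac{1-y_i}{2}\log\frac{1-y_i}{2}\big\}$ (with $0\log0=0$); $\nabla$ is the gradient in $\mathbf y$ (so $\nabla f_n(\mathbf y)-\nabla I(\mathbf y)=\beta A_n\mathbf y+B\mathbf 1-\operatorname{arctanh}(\mathbf y)$ componentwise, for $\mathbf y\in(-1,1)^n$). *)

theory Defs
  imports "HOL-Analysis.Analysis"
begin

text \<open>A matrix sequence: A n i j is the (i,j) entry of A_n, indices i, j < n
  (0-based). Vectors in R^n / [-1,1]^n / {-1,1}^n are functions nat => real,
  only the coordinates i < n matter.\<close>

definition spin_configs :: "nat \<Rightarrow> (nat \<Rightarrow> real) set" where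
  "spin_configs n = {x. (\<forall>i<n. x i = -1 \<or> x i = 1) \<and> (\<forall>i\<ge>n. x i = 0)}"

definition hamil :: "(nat \<Rightarrow> nat \<Rightarrow> nat \<Rightarrow> real) \<Rightarrow> nat \<Rightarrow> real \<Rightarrow> real \<Rightarrow> (nat \<Rightarrow> real) \<Rightarrow> real" where
  "hamil A n \<beta> B y = \<beta> / 2 * (\<Sum>i<n. \<Sum>j<n. y i * A n i j * y j) + B * (\<Sum>i<n. y i)"

definition f_n :: "(nat \<Rightarrow> nat \<Rightarrow> nat \<Rightarrow> real) \<Rightarrow> nat \<Rightarrow> real \<Rightarrow> real \<Rightarrow> (nat \<Rightarrow> real) \<Rightarrow> real" where
  "f_n A n \<beta> B y = \<beta> / 2 * (\<Sum>i<n. \<Sum>j<n. y i * A n i j * y j) + B * (\<Sum>i<n. y i)"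

definition Z_n :: "(nat \<Rightarrow> nat \<Rightarrow> nat \<Rightarrow> real) \<Rightarrow> nat \<Rightarrow> real \<Rightarrow> real \<Rightarrow> real" where
  "Z_n A n \<beta> B = (\<Sum>x\<in>spin_configs n. exp (hamil A n \<beta> B x))"

definition ising_prob :: "(nat \<Rightarrow> nat \<Rightarrow> nat \<Rightarrow> real) \<Rightarrow> nat \<Rightarrow> real \<Rightarrow> real \<Rightarrow> ((nat \<Rightarrow> real) \<Rightarrow> bool) \<Rightarrow> real" where
  "ising_prob A n \<beta> B P =
     (\<Sum>x\<in>{x\<in>spin_configs n. P x}. exp (hamil A n \<beta> B x)) / Z_n A n \<beta> B"

definition m_i :: "(nat \<Rightarrow> nat \<Rightarrow> nat \<Rightarrow> real) \<Rightarrow> nat \<Rightarrow> (nat \<Rightarrow> real) \<Rightarrow> nat \<Rightarrow> real" where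
  "m_i A n y i = (\<Sum>j<n. A n i j * y j)"

definition b_vec :: "(nat \<Rightarrow> nat \<Rightarrow> nat \<Rightarrow> real) \<Rightarrow> nat \<Rightarrow> real \<Rightarrow> real \<Rightarrow> (nat \<Rightarrow> real) \<Rightarrow> (nat \<Rightarrow> real)" where
  "b_vec A n \<beta> B y = (\<lambda>i. if i < n then tanh (\<beta> * m_i A n y i + B) else 0)"

text \<open>Entropy term; note ln 0 = 0 in Isabelle, so 0 * ln 0 = 0 as required.\<close>
definition I_n :: "nat \<Rightarrow> (nat \<Rightarrow> real) \<Rightarrow> real" where
  "I_n n y = (\<Sum>i<n. (1 + y i) / 2 * ln ((1 + y i) / 2) + (1 - y i) / 2 * ln ((1 - y i) / 2))"

definition r_n :: "(nat \<Rightarrow> nat \<Rightarrow> nat \<Rightarrow> real) \<Rightarrow> nat \<Rightarrow> real \<Rightarrow> real \<Rightarrow> real" where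
  "r_n A n \<beta> B = (SUP y\<in>{y. \<forall>i<n. y i \<in> {-1..1}}. f_n A n \<beta> B y - I_n n y)"

text \<open>Norm of grad f_n(y) - grad I(y) = beta A_n y + B 1 - artanh(y), for y in (-1,1)^n.\<close>
definition grad_norm :: "(nat \<Rightarrow> nat \<Rightarrow> nat \<Rightarrow> real) \<Rightarrow> nat \<Rightarrow> real \<Rightarrow> real \<Rightarrow> (nat \<Rightarrow> real) \<Rightarrow> real" where
  "grad_norm A n \<beta> B y = sqrt (\<Sum>i<n. (\<beta> * m_i A n y i + B - artanh (y i))\<^sup>2)"

end

theory Submission
  imports Defs
begin

text \<open>Let \<open>W(x) = |A (x - b(x))|\<^sup>2\<close>. As \<open>b\<^sub>j(X)\<close> is the conditional mean of \<open>X\<^sub>j\<close> given the other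
  spins and depends on \<open>X\<^sub>k\<close> only through a term of size \<open>\<beta> A\<^sub>j\<^sub>k\<close>, the expectation of \<open>W(X)\<close> is at
  most a constant times \<open>\<Sum> A\<^sub>i\<^sub>j\<^sup>2 = o(n)\<close>. The gradient at \<open>b(x)\<close> has norm \<open>\<beta> sqrt(W(x))\<close>, which
  is (b).

  For (a), let \<open>\<pi>\<^sub>h\<close> be the product measure with external fields \<open>h\<close> and \<open>h(x) = \<beta> A x + B\<close>. Then
  \<open>f(x) = f(b(x)) - I(b(x)) + log \<pi>\<^sub>h\<^sub>(\<^sub>x\<^sub>)(x) - \<beta>/2 (x - b(x))\<^sup>T A (x - b(x))\<close> holds exactly, and the last
  term is \<open>o(n)\<close> when \<open>W(x) = o(n)\<close>. Since \<open>Z \<ge> exp r\<^sub>n\<close> by the Gibbs variational principle, the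
  configurations with \<open>f(b(x)) - I(b(x)) \<le> r\<^sub>n - \<epsilon> n\<close> have small probability by a union bound as soon
  as the vectors \<open>A x\<close> can be approximated up to \<open>o(sqrt n)\<close> by \<open>exp(o(n))\<close> of them. Keeping each
  coordinate of \<open>x\<close> with a small probability \<open>p\<close> and rescaling by \<open>1/p\<close> provides such a net,
  because the mean squared error is at most \<open>\<Sum> A\<^sub>i\<^sub>j\<^sup>2 / p\<close>.\<close>

subsection \<open>Configurations over a finite alphabet\<close>

text \<open>Coordinates outside \<open>S\<close> are frozen at the base point \<open>z\<close>. This
  keeps the set finite, and an induction over \<open>S\<close> can move a coordinate into the base
  point as \<open>z(i := v)\<close>.\<close>

definition configs :: "'v set \<Rightarrow> 'i set \<Rightarrow> ('i \<Rightarrow> 'v) \<Rightarrow> ('i \<Rightarrow> 'v) set" where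
  "configs V S z = {x. (\<forall>i\<in>S. x i \<in> V) \<and> (\<forall>i. i \<notin> S \<longrightarrow> x i = z i)}"

lemma configs_empty [simp]: "configs V {} z = {z}"
  by (auto simp: configs_def)

lemma configs_insert:
  assumes "i \<notin> S"
  shows "configs V (insert i S) z = (\<Union>v\<in>V. configs V S (z(i := v)))"
  using assms unfolding configs_def by (auto split: if_splits)

lemma finite_configs:
  assumes "finite S" "finite V"
  shows "finite (configs V S z)"
  using assms(1) by (induction S arbitrary: z) (simp_all add: configs_insert assms(2))

lemma sum_configs_insert:
  assumes "finite S" "finite V" "i \<notin> S"
  shows "sum F (configs V (insert i S) z) = (\<Sum>v\<in>V. sum F (configs V S (z(i := v))))"
proof -
  have "configs V S (z(i := v)) \<inter> configs V S (z(i := w)) = {}" if "v \<noteq> w" for v w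
    using assms(3) that by (fastforce simp: configs_def)
  then show ?thesis
    unfolding configs_insert[OF assms(3)]
    by (intro sum.UNION_disjoint) (auto simp: finite_configs assms)
qed

text \<open>Expanding a product of one-coordinate sums gives one term per configuration. This
  evaluates both the weighted count of sparse vectors and the normalisation of product
  measures.\<close>

lemma sum_prod_configs:
  fixes g :: "'i \<Rightarrow> 'v \<Rightarrow> 'c :: comm_semiring_1"
  assumes "finite S" "finite V"
  shows "(\<Sum>x\<in>configs V S z. \<Prod>i\<in>S. g i (x i)) = (\<Prod>i\<in>S. \<Sum>v\<in>V. g i v)"
  using assms(1)
proof (induction S arbitrary: z)
  case (insert i S)
  have "(\<Sum>x\<in>configs V S (z(i := v)). \<Prod>k\<in>insert i S. g k (x k))
      = g i v * (\<Prod>k\<in>S. \<Sum>v\<in>V. g k v)" for v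
  proof -
    have "(\<Sum>x\<in>configs V S (z(i := v)). \<Prod>k\<in>insert i S. g k (x k))
        = (\<Sum>x\<in>configs V S (z(i := v)). g i v * (\<Prod>k\<in>S. g k (x k)))"
      using insert.hyps by (intro sum.cong) (auto simp: configs_def)
    then show ?thesis
      by (simp add: sum_distrib_left[symmetric] insert.IH)
  qed
  then show ?case
    using insert.hyps assms(2)
    by (simp add: sum_configs_insert sum_distrib_right)
qed simp

lemma spin_configs_eq: "spin_configs n = configs {-1, 1} {..<n} (\<lambda>_. 0)"
  by (auto simp: spin_configs_def configs_def not_less)

lemma finite_spin_configs [simp]: "finite (spin_configs n)"
  by (simp add: spin_configs_eq finite_configs)

lemma spin_configs_nonempty: "spin_configs n \<noteq> {}"
proof -
  have "(\<lambda>i. if i < n then 1 else 0) \<in> spin_configs n"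
    by (auto simp: spin_configs_def)
  then show ?thesis by blast
qed

lemma spin_square: "x \<in> spin_configs n \<Longrightarrow> i < n \<Longrightarrow> (x i)\<^sup>2 = 1"
  by (auto simp: spin_configs_def)

text \<open>Vectors with entries in \<open>{-1, 0, 1}\<close> are counted by giving a non-zero entry the
  weight \<open>t\<close>, so that a vector with at most \<open>K\<close> of them has weight at least \<open>t powr K\<close>.\<close>

lemma card_sparse_sign_vectors:
  fixes t K :: real
  assumes "0 < t" "t \<le> 1"
  shows "real (card {y \<in> configs {-1, 0, 1 :: real} {..<n} (\<lambda>_. 0). real (card {i. i < n \<and> y i \<noteq> 0}) \<le> K})
    \<le> exp (2 * t * real n + K * ln (1 / t))"
    (is "real (card ?Y) \<le> _")
proof -
  let ?C = "configs {-1, 0, 1 :: real} {..<n} (\<lambda>_. 0)"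
  let ?w = "\<lambda>y :: nat \<Rightarrow> real. \<Prod>i<n. if y i = 0 then 1 else t"
  have w: "t powr K \<le> ?w y" if "y \<in> ?Y" for y
  proof -
    have "?w y = t ^ card {i. i < n \<and> y i \<noteq> 0}"
      by (simp add: prod.If_cases flip: lessThan_iff) (simp add: Int_def Compl_eq)
    also have "\<dots> = t powr real (card {i. i < n \<and> y i \<noteq> 0})"
      using assms by (simp add: powr_realpow)
    finally show ?thesis
      using that assms by (auto intro: powr_mono')
  qed
  have "t powr K * real (card ?Y) = (\<Sum>y\<in>?Y. t powr K)"
    by simp
  also have "\<dots> \<le> (\<Sum>y\<in>?Y. ?w y)"
    using w by (rule sum_mono)
  also have "\<dots> \<le> (\<Sum>y\<in>?C. ?w y)"
    using assms by (intro sum_mono2) (auto simp: finite_configs intro!: prod_nonneg)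
  \<comment> \<open>Each coordinate contributes \<open>1\<close> for the value \<open>0\<close> and
    \<open>t\<close> for each of the two signs.\<close>
  also have "\<dots> = (1 + 2 * t) ^ n"
    by (subst sum_prod_configs) (auto simp: add.commute)
  also have "\<dots> \<le> exp (2 * t) ^ n"
    using assms by (intro power_mono) auto
  finally have "t powr K * real (card ?Y) \<le> exp (2 * t * real n)"
    by (simp add: exp_of_nat_mult[symmetric] mult.commute)
  then have "exp (K * ln (1 / t)) * (t powr K * real (card ?Y))
      \<le> exp (K * ln (1 / t)) * exp (2 * t * real n)"
    by simp
  moreover have "exp (K * ln (1 / t)) * t powr K = 1"
    using assms by (simp add: powr_def ln_div mult_exp_exp)
  ultimately show ?thesis
    by (simp add: mult_exp_exp mult.assoc[symmetric] add.commute)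
qed

subsection \<open>Sparse approximation of sums of vectors\<close>

text \<open>Derandomised Maurey sampling: keep each index with probability \<open>p\<close> and weight
  \<open>1 / p\<close>. Adding an index raises the expectation of the left-hand side by at most its share
  of the right-hand side, so one of the two choices does no worse than the average.\<close>

lemma sparse_approximation:
  fixes v :: "'i \<Rightarrow> 'j \<Rightarrow> real"
  assumes "finite J" and p: "0 < p" "p \<le> 1"
  shows "\<exists>S\<subseteq>J. (\<Sum>i\<in>I. (\<Sum>j\<in>J. ((if j \<in> S then 1 / p else 0) - 1) * v i j)\<^sup>2) + real (card S)
    \<le> (1 / p - 1) * (\<Sum>j\<in>J. \<Sum>i\<in>I. (v i j)\<^sup>2) + p * real (card J)"
  using assms(1)
proof (induction J)
  case (insert k J)
  then obtain S where S: "S \<subseteq> J" and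
    le: "(\<Sum>i\<in>I. (\<Sum>j\<in>J. ((if j \<in> S then 1 / p else 0) - 1) * v i j)\<^sup>2) + real (card S)
      \<le> (1 / p - 1) * (\<Sum>j\<in>J. \<Sum>i\<in>I. (v i j)\<^sup>2) + p * real (card J)"
    by auto
  let ?u = "\<lambda>i. \<Sum>j\<in>J. ((if j \<in> S then 1 / p else 0) - 1) * v i j"
  let ?R = "(1 / p - 1) * (\<Sum>j\<in>insert k J. \<Sum>i\<in>I. (v i j)\<^sup>2) + p * real (card (insert k J))"
  have kS: "k \<notin> S" and fS: "finite S"
    using S insert.hyps by (auto intro: finite_subset)
  \<comment> \<open>\<open>?a\<close> and \<open>?b\<close> are the objective with \<open>k\<close>
    kept, which costs one more element, and with \<open>k\<close> dropped.\<close>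
  let ?a = "(\<Sum>i\<in>I. (?u i + (1 / p - 1) * v i k)\<^sup>2) + real (card S) + 1"
  let ?b = "(\<Sum>i\<in>I. (?u i - v i k)\<^sup>2) + real (card S)"
  \<comment> \<open>The factor of \<open>w\<close> is \<open>1 / p - 1\<close> with probability
    \<open>p\<close> and \<open>-1\<close> otherwise: it has mean zero, so there is no cross term,
    and variance \<open>1 / p - 1\<close>.\<close>
  have "p * (u + (1 / p - 1) * w)\<^sup>2 + (1 - p) * (u - w)\<^sup>2 = u\<^sup>2 + (1 / p - 1) * w\<^sup>2" for u w :: real
    using p by (simp add: field_simps power2_eq_square)
  then have "p * (\<Sum>i\<in>I. (?u i + (1 / p - 1) * v i k)\<^sup>2) + (1 - p) * (\<Sum>i\<in>I. (?u i - v i k)\<^sup>2)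
      = (\<Sum>i\<in>I. (?u i)\<^sup>2) + (1 / p - 1) * (\<Sum>i\<in>I. (v i k)\<^sup>2)"
    by (simp add: sum_distrib_left sum.distrib[symmetric])
  then have "p * ?a + (1 - p) * ?b
      = (\<Sum>i\<in>I. (?u i)\<^sup>2) + real (card S) + (1 / p - 1) * (\<Sum>i\<in>I. (v i k)\<^sup>2) + p"
    by (simp add: algebra_simps)
  also have "\<dots> \<le> ?R"
    using le insert.hyps by (simp add: distrib_left)
  finally have avg: "p * ?a + (1 - p) * ?b \<le> ?R" .
  have "?a \<le> ?R \<or> ?b \<le> ?R"
  proof (rule ccontr)
    assume "\<not> (?a \<le> ?R \<or> ?b \<le> ?R)"
    then have "p * ?R < p * ?a" "(1 - p) * ?R \<le> (1 - p) * ?b"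
      using p by (auto intro!: mult_left_mono)
    moreover have "p * r + (1 - p) * r = r" for r
      by (simp add: algebra_simps)
    note this[of ?R]
    ultimately show False
      using avg by linarith
  qed
  then show ?case
  proof
    assume a: "?a \<le> ?R"
    have "(\<Sum>j\<in>insert k J. ((if j \<in> insert k S then 1 / p else 0) - 1) * v i j)
        = ?u i + (1 / p - 1) * v i k" for i
    proof -
      have "(\<Sum>j\<in>J. ((if j \<in> insert k S then 1 / p else 0) - 1) * v i j) = ?u i"
        using insert.hyps by (intro sum.cong) auto
      then show ?thesis
        using insert.hyps by simp
    qed
    then show ?thesis
      using a S kS fS by (intro exI[of _ "insert k S"]) (auto simp: add.commute)
  next
    assume b: "?b \<le> ?R"
    have "(\<Sum>j\<in>insert k J. ((if j \<in> S then 1 / p else 0) - 1) * v i j) = ?u i - v i k" for i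
      using insert.hyps kS by simp
    then show ?thesis
      using b S by (intro exI[of _ S]) auto
  qed
qed auto

subsection \<open>The Gibbs variational lower bound\<close>

definition binary_entropy_term :: "real \<Rightarrow> real" where
  "binary_entropy_term t = (1 + t) / 2 * ln ((1 + t) / 2) + (1 - t) / 2 * ln ((1 - t) / 2)"

lemma I_n_eq: "I_n n y = (\<Sum>i<n. binary_entropy_term (y i))"
  by (simp add: I_n_def binary_entropy_term_def)

text \<open>Jensen's inequality for \<open>exp\<close> with weights \<open>(1 + t) / 2\<close> and
  \<open>(1 - t) / 2\<close>, applied to \<open>a\<close> and \<open>b\<close> minus the logarithms
  of their weights, so that the weights cancel.\<close>

lemma two_point_gibbs:
  fixes a b t :: real
  assumes "t \<in> {-1..1}"
  shows "exp ((1 + t) / 2 * a + (1 - t) / 2 * b - binary_entropy_term t) \<le> exp a + exp b"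
proof (cases "t = -1 \<or> t = 1")
  \<comment> \<open>At the endpoints the entropy is \<open>0\<close> by the convention
    \<open>0 * ln 0 = 0\<close>, and the left side is one of the two exponentials.\<close>
  case True
  then show ?thesis
    by (auto simp: binary_entropy_term_def)
next
  case False
  define p where "p = (1 + t) / 2"
  have p: "0 < p" "p < 1" and q: "(1 - t) / 2 = 1 - p"
    using assms False by (auto simp: p_def field_simps)
  have "exp ((1 - (1 - p)) *\<^sub>R (a - ln p) + (1 - p) *\<^sub>R (b - ln (1 - p)))
      \<le> (1 - (1 - p)) * exp (a - ln p) + (1 - p) * exp (b - ln (1 - p))"
    by (rule convex_onD[OF exp_convex]) (use p in auto)
  also have "\<dots> = exp a + exp b"
    using p by (simp add: exp_diff)
  finally show ?thesis
    unfolding binary_entropy_term_def q p_def[symmetric] by (simp add: algebra_simps)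
qed

text \<open>Replacing the coordinates of \<open>z\<close> by \<open>\<plusminus>1\<close> one at a time, each step costs the two-point
  inequality.\<close>

lemma gibbs_lower_bound:
  fixes F :: "(nat \<Rightarrow> real) \<Rightarrow> real"
  assumes "finite S"
    and "\<And>i. i \<in> S \<Longrightarrow> z i \<in> {-1..1}"
    and "\<And>i y. i \<in> S \<Longrightarrow> F y = (1 + y i) / 2 * F (y(i := 1)) + (1 - y i) / 2 * F (y(i := -1))"
  shows "exp (F z - (\<Sum>i\<in>S. binary_entropy_term (z i))) \<le> (\<Sum>x\<in>configs {-1, 1} S z. exp (F x))"
  using assms
proof (induction S arbitrary: z)
  case (insert k S)
  let ?s = "\<Sum>i\<in>S. binary_entropy_term (z i)"
  have step: "exp (F (z(k := v)) - ?s) \<le> (\<Sum>x\<in>configs {-1, 1} S (z(k := v)). exp (F x))" for v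
  proof -
    have "(\<Sum>i\<in>S. binary_entropy_term ((z(k := v)) i)) = ?s"
      using insert.hyps by (intro sum.cong) auto
    moreover have "exp (F (z(k := v)) - (\<Sum>i\<in>S. binary_entropy_term ((z(k := v)) i)))
        \<le> (\<Sum>x\<in>configs {-1, 1} S (z(k := v)). exp (F x))"
    proof (rule insert.IH)
      show "(z(k := v)) i \<in> {-1..1}" if "i \<in> S" for i
        using insert.prems(1)[of i] insert.hyps that by auto
    qed (use insert.prems(2) in blast)
    ultimately show ?thesis by simp
  qed
  \<comment> \<open>\<open>F\<close> is affine in coordinate \<open>k\<close>, so \<open>F z\<close>
    is the mixture of its values at \<open>1\<close> and \<open>-1\<close> with mean spin
    \<open>z k\<close>; this is the form the two-point inequality needs.\<close>
  have "F z = (1 + z k) / 2 * a + (1 - z k) / 2 * b"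
    if "a = F (z(k := 1))" "b = F (z(k := -1))" for a b
    unfolding that by (rule insert.prems(2)) simp
  then have "F z - (\<Sum>i\<in>insert k S. binary_entropy_term (z i))
      = (1 + z k) / 2 * (F (z(k := 1)) - ?s) + (1 - z k) / 2 * (F (z(k := -1)) - ?s)
        - binary_entropy_term (z k)"
    unfolding sum.insert[OF insert.hyps] by (simp add: field_simps)
  then have "exp (F z - (\<Sum>i\<in>insert k S. binary_entropy_term (z i)))
      \<le> exp (F (z(k := 1)) - ?s) + exp (F (z(k := -1)) - ?s)"
    using two_point_gibbs[OF insert.prems(1)[of k]] by auto
  also have "\<dots> \<le> (\<Sum>x\<in>configs {-1, 1} S (z(k := 1)). exp (F x))
      + (\<Sum>x\<in>configs {-1, 1} S (z(k := -1)). exp (F x))"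
    by (intro add_mono step)
  also have "\<dots> = (\<Sum>x\<in>configs {-1, 1} (insert k S) z. exp (F x))"
    using insert.hyps by (simp add: sum_configs_insert)
  finally show ?case .
qed simp

subsection \<open>Hyperbolic functions\<close>

lemma tanh_real_Lipschitz: "\<bar>tanh a - tanh b\<bar> \<le> \<bar>a - b\<bar>" for a b :: real
proof -
  have "norm (tanh a - tanh b) \<le> 1 * norm (a - b)"
  proof (rule field_differentiable_bound[where S = UNIV and f' = "\<lambda>x. 1 - (tanh x)\<^sup>2"])
    show "(tanh has_field_derivative 1 - (tanh x)\<^sup>2) (at x within UNIV)" for x :: real
      by (auto intro!: derivative_eq_intros)
    show "norm (1 - (tanh x)\<^sup>2) \<le> 1" for x :: real
      using tanh_real_bounds[of x] by (auto simp: abs_square_le_1 abs_le_iff)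
  qed auto
  then show ?thesis by simp
qed

lemma tanh_eq_exp: "tanh h = (exp h - exp (-h)) / (exp h + exp (-h))" for h :: real
  by (simp add: tanh_altdef)

text \<open>Log-partition function of one spin in the external field \<open>h\<close>, equal to
  \<open>ln (2 * cosh h)\<close>.\<close>

definition log_cosh2 :: "real \<Rightarrow> real" where
  "log_cosh2 h = ln (exp h + exp (-h))"

lemma exp_log_cosh2: "exp (log_cosh2 h) = exp h + exp (-h)"
  by (simp add: log_cosh2_def add_pos_pos)

lemma log_cosh2_Lipschitz: "\<bar>log_cosh2 a - log_cosh2 b\<bar> \<le> \<bar>a - b\<bar>"
proof -
  have "log_cosh2 a \<le> \<bar>a - b\<bar> + log_cosh2 b" for a b
  proof -
    \<comment> \<open>Each of \<open>a\<close> and \<open>- a\<close> exceeds \<open>b\<close> and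
      \<open>- b\<close> respectively by at most \<open>\<bar>a - b\<bar>\<close>, which becomes a
      common factor.\<close>
    have "exp (log_cosh2 a) \<le> exp (\<bar>a - b\<bar> + b) + exp (\<bar>a - b\<bar> + - b)"
      unfolding exp_log_cosh2 by (intro add_mono) auto
    also have "\<dots> = exp (\<bar>a - b\<bar> + log_cosh2 b)"
      unfolding exp_add exp_log_cosh2 by (simp add: distrib_left)
    finally show ?thesis by simp
  qed
  from this[of a b] this[of b a] show ?thesis by linarith
qed

text \<open>Legendre duality: \<open>tanh\<close> is the derivative of \<open>log_cosh2\<close>,
  whose convex conjugate is the negative entropy. The numbers
  \<open>(1 \<plusminus> tanh h) / 2\<close> are the Gibbs probabilities of the two spin values in
  the field \<open>h\<close>.\<close>

lemma binary_entropy_term_tanh: "binary_entropy_term (tanh h) = h * tanh h - log_cosh2 h"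
proof -
  have pos: "exp h + exp (-h) > 0" by (simp add: add_pos_pos)
  have 1: "(1 + tanh h) / 2 = exp h / (exp h + exp (-h))"
    and 2: "(1 - tanh h) / 2 = exp (-h) / (exp h + exp (-h))"
    unfolding tanh_eq_exp using pos by (simp_all add: field_simps)
  have ln: "ln ((1 + tanh h) / 2) = h - log_cosh2 h" "ln ((1 - tanh h) / 2) = - h - log_cosh2 h"
    unfolding 1 2 log_cosh2_def using pos by (simp_all add: ln_div)
  then show ?thesis
    unfolding binary_entropy_term_def ln by (simp add: field_simps)
qed

text \<open>\<open>exp (- 2 * s * h)\<close> is the Gibbs weight of the spin \<open>- s\<close>
  relative to \<open>s\<close>, and \<open>tanh h\<close> is the mean spin, so the centred spin
  averages to zero.\<close>

lemma spin_flip_balance: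
  fixes h s :: real
  assumes "s = -1 \<or> s = 1"
  shows "s - tanh h + exp (- 2 * s * h) * (- s - tanh h) = 0"
proof -
  have "1 - tanh k + exp (- 2 * k) * (- 1 - tanh k) = 0" for k :: real
  proof -
    have "1 + exp (- 2 * k) > 0" by (simp add: add_pos_pos)
    then show ?thesis
      unfolding tanh_real_altdef by (simp add: field_simps)
  qed
  from this[of h] this[of "-h"] show ?thesis
    using assms by (auto simp: algebra_simps)
qed

subsection \<open>The mean-field residual\<close>

text \<open>All bounds here are non-asymptotic, for one fixed \<open>n\<close>; the mean-field
  condition enters only through the size of \<open>frob\<close>.\<close>

locale ising =
  fixes A :: "nat \<Rightarrow> nat \<Rightarrow> nat \<Rightarrow> real" and n :: nat and \<beta> B \<gamma> :: real
  assumes symm: "\<And>i j. i < n \<Longrightarrow> j < n \<Longrightarrow> A n i j = A n j i"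
    and nonneg: "\<And>i j. i < n \<Longrightarrow> j < n \<Longrightarrow> A n i j \<ge> 0"
    and diag: "\<And>i. i < n \<Longrightarrow> A n i i = 0"
    and row_sum: "\<And>i. i < n \<Longrightarrow> (\<Sum>j<n. A n i j) \<le> \<gamma>"
    and gamma: "\<gamma> \<ge> 0"
    and beta: "\<beta> > 0"
begin

abbreviation "m \<equiv> m_i A n"
abbreviation "F \<equiv> f_n A n \<beta> B"
abbreviation "b \<equiv> b_vec A n \<beta> B"
abbreviation "Z \<equiv> Z_n A n \<beta> B"
abbreviation "r \<equiv> r_n A n \<beta> B"
abbreviation "frob \<equiv> \<Sum>i<n. \<Sum>j<n. (A n i j)\<^sup>2"

definition local_field :: "(nat \<Rightarrow> real) \<Rightarrow> nat \<Rightarrow> real" where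
  "local_field x i = \<beta> * m x i + B"

definition dev :: "(nat \<Rightarrow> real) \<Rightarrow> nat \<Rightarrow> real" where
  "dev x i = x i - b x i"

text \<open>The \<open>W\<close> of the introduction. It vanishes exactly when \<open>b x\<close>
  solves the mean-field equation \<open>b (b x) = b x\<close>.\<close>

definition residual :: "(nat \<Rightarrow> real) \<Rightarrow> real" where
  "residual x = (\<Sum>i<n. (m (dev x) i)\<^sup>2)"

lemma b_eq: "i < n \<Longrightarrow> b x i = tanh (local_field x i)"
  by (simp add: b_vec_def local_field_def)

lemma F_eq: "F y = \<beta> / 2 * (\<Sum>i<n. y i * m y i) + B * (\<Sum>i<n. y i)"
  by (simp add: f_n_def m_i_def sum_distrib_left mult.assoc)

lemma Z_eq: "Z = (\<Sum>x\<in>spin_configs n. exp (F x))"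
  by (simp add: Z_n_def hamil_def f_n_def)

lemma Z_pos: "Z > 0"
  unfolding Z_eq by (intro sum_pos) (auto simp: spin_configs_nonempty)

section \<open>Union and Markov bounds for the Ising measure\<close>

lemma ising_prob_eq: "ising_prob A n \<beta> B P = (\<Sum>x\<in>{x\<in>spin_configs n. P x}. exp (F x)) / Z"
  by (simp add: ising_prob_def hamil_def f_n_def)

lemma ising_prob_nonneg: "ising_prob A n \<beta> B P \<ge> 0"
  unfolding ising_prob_eq using Z_pos by (intro divide_nonneg_pos sum_nonneg) auto

lemma ising_prob_mono:
  assumes "\<And>x. x \<in> spin_configs n \<Longrightarrow> P x \<Longrightarrow> Q x"
  shows "ising_prob A n \<beta> B P \<le> ising_prob A n \<beta> B Q"
  unfolding ising_prob_eq using Z_pos assms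
  by (intro divide_right_mono sum_mono2) auto

lemma ising_prob_disj:
  "ising_prob A n \<beta> B (\<lambda>x. P x \<or> Q x) \<le> ising_prob A n \<beta> B P + ising_prob A n \<beta> B Q"
proof -
  have "{x \<in> spin_configs n. P x \<or> Q x} = {x \<in> spin_configs n. P x} \<union> {x \<in> spin_configs n. Q x}"
    by auto
  moreover have "(\<Sum>x\<in>S \<union> T. exp (F x)) \<le> (\<Sum>x\<in>S. exp (F x)) + (\<Sum>x\<in>T. exp (F x))"
    if "finite S" "finite T" for S T
    using that by (simp add: sum_Un sum_nonneg)
  ultimately show ?thesis
    unfolding ising_prob_eq add_divide_distrib[symmetric]
    using Z_pos by (intro divide_right_mono) auto
qed

lemma ising_prob_Markov:
  assumes "c > 0" "\<And>x. g x \<ge> 0"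
  shows "ising_prob A n \<beta> B (\<lambda>x. g x > c) \<le> (\<Sum>x\<in>spin_configs n. exp (F x) * g x) / Z / c"
proof -
  have "c * (\<Sum>x\<in>{x\<in>spin_configs n. g x > c}. exp (F x))
      \<le> (\<Sum>x\<in>{x\<in>spin_configs n. g x > c}. exp (F x) * g x)"
    unfolding sum_distrib_left by (intro sum_mono) (simp add: mult.commute)
  also have "\<dots> \<le> (\<Sum>x\<in>spin_configs n. exp (F x) * g x)"
    using assms by (intro sum_mono2) auto
  finally show ?thesis
    unfolding ising_prob_eq using assms Z_pos by (simp add: field_simps)
qed

section \<open>Changing one coordinate, and correlations of the deviations\<close>

lemma m_upd:
  assumes "k < n"
  shows "m (y(k := t)) i = m y i + A n i k * (t - y k)"
proof -
  have "A n i j * (y(k := t)) j = A n i j * y j + (if j = k then A n i k * (t - y k) else 0)" for j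
    by (simp add: algebra_simps)
  then show ?thesis
    using assms unfolding m_i_def by (simp add: sum.distrib)
qed

text \<open>The zero diagonal removes the term quadratic in \<open>t\<close>, and symmetry makes row
  \<open>k\<close> and column \<open>k\<close> contribute equally. So \<open>F\<close> is affine in
  each coordinate, with the local field as slope.\<close>

lemma F_upd:
  assumes k: "k < n"
  shows "F (y(k := t)) = F y + (t - y k) * local_field y k"
proof -
  let ?d = "t - y k"
  have "(y(k := t)) i * m (y(k := t)) i
      = y i * m y i + ?d * (A n i k * y i) + (if i = k then ?d * m y k + ?d * ?d * A n k k else 0)" for i
    unfolding m_upd[OF k] by (simp add: algebra_simps)
  then have "(\<Sum>i<n. (y(k := t)) i * m (y(k := t)) i)
      = (\<Sum>i<n. y i * m y i) + ?d * (\<Sum>i<n. A n i k * y i) + ?d * m y k + ?d * ?d * A n k k"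
    using k by (simp add: sum.distrib sum_distrib_left)
  also have "(\<Sum>i<n. A n i k * y i) = m y k"
    unfolding m_i_def using k by (intro sum.cong) (auto simp: symm)
  also have "(\<Sum>i<n. y i * m y i) + ?d * m y k + ?d * m y k + ?d * ?d * A n k k
      = (\<Sum>i<n. y i * m y i) + 2 * (?d * m y k)"
    using k by (simp add: diag)
  finally have q: "(\<Sum>i<n. (y(k := t)) i * m (y(k := t)) i) = (\<Sum>i<n. y i * m y i) + 2 * (?d * m y k)" .
  have "(y(k := t)) i = y i + (if i = k then ?d else 0)" for i
    by simp
  then have l: "(\<Sum>i<n. (y(k := t)) i) = (\<Sum>i<n. y i) + ?d"
    using k by (simp add: sum.distrib)
  then show ?thesis
    unfolding F_eq q l local_field_def by (simp add: algebra_simps)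
qed

lemma local_field_upd_self: "k < n \<Longrightarrow> local_field (y(k := t)) k = local_field y k"
  by (simp add: local_field_def m_upd diag)

lemma abs_dev_le:
  assumes "x \<in> spin_configs n" "i < n"
  shows "\<bar>dev x i\<bar> \<le> 2"
  using tanh_real_bounds[of "local_field x i"] assms
  by (auto simp: dev_def b_eq spin_configs_def)

text \<open>Since \<open>A\<close> has zero diagonal, \<open>b x k\<close> is the conditional mean of the spin \<open>k\<close> given
  the other ones.\<close>

lemma sum_dev_eq_0:
  assumes k: "k < n" and g: "\<And>x. g (x(k := - x k)) = g x"
  shows "(\<Sum>x\<in>spin_configs n. exp (F x) * (dev x k * g x)) = 0"
proof -
  \<comment> \<open>Flipping spin \<open>k\<close> permutes the configurations, so the sum can be
    added to its flipped copy; each pair of terms cancels by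
    \<open>spin_flip_balance\<close>.\<close>
  define T where "T x = x(k := - x k)" for x :: "nat \<Rightarrow> real"
  let ?\<phi> = "\<lambda>x. exp (F x) * (dev x k * g x)"
  have "(\<Sum>x\<in>spin_configs n. ?\<phi> x) = (\<Sum>x\<in>spin_configs n. ?\<phi> (T x))"
    using k by (intro sum.reindex_bij_witness[of _ T T]) (auto simp: T_def spin_configs_def)
  moreover have "?\<phi> x + ?\<phi> (T x) = 0" if x: "x \<in> spin_configs n" for x
  proof -
    let ?h = "local_field x k"
    have "F (T x) = F x + (- 2 * x k * ?h)"
      unfolding T_def F_upd[OF k] by simp
    then have e1: "exp (F (T x)) = exp (F x) * exp (- 2 * x k * ?h)"
      by (simp only: exp_add)
    have e2: "dev (T x) k = - x k - tanh ?h"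
      using k by (simp add: dev_def b_eq T_def local_field_upd_self)
    have e3: "g (T x) = g x"
      by (simp add: T_def g)
    have e4: "dev x k = x k - tanh ?h"
      using k by (simp add: dev_def b_eq)
    have "?\<phi> x + ?\<phi> (T x)
        = exp (F x) * g x * (x k - tanh ?h + exp (- 2 * x k * ?h) * (- x k - tanh ?h))"
      unfolding e1 e2 e3 e4 by (simp add: algebra_simps)
    also have "\<dots> = 0"
      using x k by (subst spin_flip_balance) (auto simp: spin_configs_def)
    finally show ?thesis .
  qed
  then have "(\<Sum>x\<in>spin_configs n. ?\<phi> x) + (\<Sum>x\<in>spin_configs n. ?\<phi> (T x)) = 0"
    by (simp add: sum.distrib[symmetric])
  ultimately show ?thesis by linarith
qed

text \<open>For \<open>j = k\<close> both factors are at most \<open>2\<close> in modulus. Otherwise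
  \<open>dev x k\<close> depends on spin \<open>j\<close> only through its field; with that
  dependence removed its correlation with \<open>dev x j\<close> vanishes, and the removal costs at
  most \<open>\<beta> * A n k j\<close>.\<close>

lemma dev_correlation:
  assumes j: "j < n" and k: "k < n"
  shows "(\<Sum>x\<in>spin_configs n. exp (F x) * (dev x j * dev x k))
    \<le> ((if j = k then 4 else 0) + 2 * \<beta> * A n k j) * Z"
proof (cases "j = k")
  case True
  have "exp (F x) * (dev x k * dev x k) \<le> 4 * exp (F x)" if "x \<in> spin_configs n" for x
  proof -
    have "dev x k * dev x k = \<bar>dev x k\<bar> * \<bar>dev x k\<bar>"
      by (simp add: abs_mult[symmetric])
    also have "\<dots> \<le> 2 * 2"
      using abs_dev_le[OF that k] by (intro mult_mono) auto
    finally show ?thesis by simp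
  qed
  then have "(\<Sum>x\<in>spin_configs n. exp (F x) * (dev x k * dev x k)) \<le> (\<Sum>x\<in>spin_configs n. 4 * exp (F x))"
    by (intro sum_mono)
  then show ?thesis
    using True k by (simp add: diag Z_eq sum_distrib_left)
next
  case False
  \<comment> \<open>Evaluating the field at \<open>x j = 0\<close> makes \<open>g\<close>
    independent of spin \<open>j\<close> and moves the field by exactly
    \<open>\<beta> * A n k j\<close> in modulus.\<close>
  define g where "g x = x k - tanh (local_field (x(j := 0)) k)" for x :: "nat \<Rightarrow> real"
  have "g (x(j := - x j)) = g x" for x
    using False by (simp add: g_def)
  then have 0: "(\<Sum>x\<in>spin_configs n. exp (F x) * (dev x j * g x)) = 0"
    by (rule sum_dev_eq_0[OF j])
  have bd: "exp (F x) * (dev x j * (dev x k - g x)) \<le> exp (F x) * (2 * (\<beta> * A n k j))"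
    if x: "x \<in> spin_configs n" for x
  proof -
    have xj: "\<bar>x j\<bar> = 1"
      using x j by (auto simp: spin_configs_def)
    have "\<bar>dev x k - g x\<bar> \<le> \<bar>local_field (x(j := 0)) k - local_field x k\<bar>"
      using tanh_real_Lipschitz[of "local_field (x(j := 0)) k" "local_field x k"] k
      by (simp add: dev_def g_def b_eq)
    also have "\<dots> = \<beta> * A n k j"
      using beta nonneg[OF k j] xj j by (simp add: local_field_def m_upd right_diff_distrib abs_mult)
    finally have "\<bar>dev x k - g x\<bar> \<le> \<beta> * A n k j" .
    then have "\<bar>dev x j\<bar> * \<bar>dev x k - g x\<bar> \<le> 2 * (\<beta> * A n k j)"
      using abs_dev_le[OF x j] by (intro mult_mono) auto
    then have "dev x j * (dev x k - g x) \<le> 2 * (\<beta> * A n k j)"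
      by (metis abs_mult abs_ge_self order_trans)
    then show ?thesis by simp
  qed
  have "(\<Sum>x\<in>spin_configs n. exp (F x) * (dev x j * dev x k))
      = (\<Sum>x\<in>spin_configs n. exp (F x) * (dev x j * (dev x k - g x)))"
    using 0 by (simp add: right_diff_distrib sum_subtractf)
  also have "\<dots> \<le> (\<Sum>x\<in>spin_configs n. exp (F x) * (2 * (\<beta> * A n k j)))"
    using bd by (rule sum_mono)
  also have "\<dots> = 2 * (\<beta> * A n k j) * Z"
    unfolding Z_eq sum_distrib_right[symmetric] by (rule mult.commute)
  finally show ?thesis
    using False by (simp add: mult.assoc)
qed

text \<open>Bound \<open>A n i k * A n k j\<close> by the mean of the two squares. The remaining
  factor \<open>A n i j\<close> is then summed along a row in one half and, by symmetry, along a
  column in the other, giving at most \<open>\<gamma>\<close> each time.\<close>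

lemma triangle_sum_le: "(\<Sum>i<n. \<Sum>j<n. \<Sum>k<n. A n i j * A n i k * A n k j) \<le> \<gamma> * frob"
proof -
  have "A n i j * A n i k * A n k j \<le> (A n i j * (A n i k)\<^sup>2 + A n i j * (A n k j)\<^sup>2) / 2"
    if "i < n" "j < n" "k < n" for i j k
  proof -
    have "A n i k * A n k j \<le> ((A n i k)\<^sup>2 + (A n k j)\<^sup>2) / 2"
      using sum_squares_bound[of "A n i k" "A n k j"] by simp
    from mult_left_mono[OF this nonneg[OF that(1,2)]] show ?thesis
      by (simp add: algebra_simps)
  qed
  then have "(\<Sum>i<n. \<Sum>j<n. \<Sum>k<n. A n i j * A n i k * A n k j)
      \<le> (\<Sum>i<n. \<Sum>j<n. \<Sum>k<n. (A n i j * (A n i k)\<^sup>2 + A n i j * (A n k j)\<^sup>2) / 2)"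
    by (intro sum_mono) auto
  also have "\<dots> = ((\<Sum>i<n. \<Sum>j<n. \<Sum>k<n. A n i j * (A n i k)\<^sup>2)
      + (\<Sum>i<n. \<Sum>j<n. \<Sum>k<n. A n i j * (A n k j)\<^sup>2)) / 2"
    by (simp add: sum.distrib sum_divide_distrib[symmetric])
  also have "\<dots> \<le> (\<gamma> * frob + \<gamma> * frob) / 2"
  proof (intro divide_right_mono add_mono)
    have "(\<Sum>i<n. \<Sum>j<n. \<Sum>k<n. A n i j * (A n i k)\<^sup>2) = (\<Sum>i<n. (\<Sum>j<n. A n i j) * (\<Sum>k<n. (A n i k)\<^sup>2))"
      by (simp add: sum_product)
    also have "\<dots> \<le> (\<Sum>i<n. \<gamma> * (\<Sum>k<n. (A n i k)\<^sup>2))"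
      by (intro sum_mono mult_right_mono row_sum sum_nonneg) auto
    finally show "(\<Sum>i<n. \<Sum>j<n. \<Sum>k<n. A n i j * (A n i k)\<^sup>2) \<le> \<gamma> * frob"
      by (simp add: sum_distrib_left)
    have "(\<Sum>i<n. \<Sum>j<n. \<Sum>k<n. A n i j * (A n k j)\<^sup>2) = (\<Sum>j<n. \<Sum>i<n. \<Sum>k<n. A n i j * (A n k j)\<^sup>2)"
      by (rule sum.swap)
    also have "\<dots> = (\<Sum>j<n. (\<Sum>i<n. A n i j) * (\<Sum>k<n. (A n k j)\<^sup>2))"
      by (simp add: sum_product)
    also have "\<dots> \<le> (\<Sum>j<n. \<gamma> * (\<Sum>k<n. (A n k j)\<^sup>2))"
    proof (intro sum_mono mult_right_mono sum_nonneg)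
      fix j assume j: "j \<in> {..<n}"
      have "(\<Sum>i<n. A n i j) = (\<Sum>i<n. A n j i)"
        using j by (intro sum.cong) (auto simp: symm)
      then show "(\<Sum>i<n. A n i j) \<le> \<gamma>"
        using row_sum[of j] j by simp
    qed auto
    also have "\<dots> = \<gamma> * (\<Sum>j<n. \<Sum>k<n. (A n k j)\<^sup>2)"
      by (simp add: sum_distrib_left)
    also have "(\<Sum>j<n. \<Sum>k<n. (A n k j)\<^sup>2) = frob"
      by (rule sum.swap)
    finally show "(\<Sum>i<n. \<Sum>j<n. \<Sum>k<n. A n i j * (A n k j)\<^sup>2) \<le> \<gamma> * frob" .
  qed simp
  finally show ?thesis by simp
qed

text \<open>Expanding the squares leaves pair correlations with non-negative coefficients, so the
  one-sided bound \<open>dev_correlation\<close> suffices. Its diagonal part sums to a multiple of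
  \<open>frob\<close>, the rest to the triangle sum.\<close>

lemma residual_moment:
  "(\<Sum>x\<in>spin_configs n. exp (F x) * residual x) \<le> (4 + 2 * \<beta> * \<gamma>) * frob * Z"
proof -
  have "residual x = (\<Sum>i<n. \<Sum>j<n. \<Sum>k<n. (A n i j * A n i k) * (dev x j * dev x k))" for x
    unfolding residual_def m_i_def power2_eq_square sum_product by (simp add: mult_ac)
  then have "(\<Sum>x\<in>spin_configs n. exp (F x) * residual x)
      = (\<Sum>x\<in>spin_configs n. \<Sum>i<n. \<Sum>j<n. \<Sum>k<n.
          (A n i j * A n i k) * (exp (F x) * (dev x j * dev x k)))"
    by (simp add: sum_distrib_left mult_ac)
  also have "\<dots> = (\<Sum>i<n. \<Sum>x\<in>spin_configs n. \<Sum>j<n. \<Sum>k<n.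
          (A n i j * A n i k) * (exp (F x) * (dev x j * dev x k)))"
    by (rule sum.swap)
  also have "\<dots> = (\<Sum>i<n. \<Sum>j<n. \<Sum>x\<in>spin_configs n. \<Sum>k<n.
          (A n i j * A n i k) * (exp (F x) * (dev x j * dev x k)))"
    by (intro sum.cong sum.swap refl)
  also have "\<dots> = (\<Sum>i<n. \<Sum>j<n. \<Sum>k<n. \<Sum>x\<in>spin_configs n.
          (A n i j * A n i k) * (exp (F x) * (dev x j * dev x k)))"
    by (intro sum.cong sum.swap refl)
  also have "\<dots> = (\<Sum>i<n. \<Sum>j<n. \<Sum>k<n.
          (A n i j * A n i k) * (\<Sum>x\<in>spin_configs n. exp (F x) * (dev x j * dev x k)))"
    by (simp add: sum_distrib_left)
  also have "\<dots> \<le> (\<Sum>i<n. \<Sum>j<n. \<Sum>k<n.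
          (A n i j * A n i k) * (((if j = k then 4 else 0) + 2 * \<beta> * A n k j) * Z))"
    by (intro sum_mono mult_left_mono dev_correlation mult_nonneg_nonneg nonneg) auto
  also have "\<dots> = (\<Sum>i<n. \<Sum>j<n. \<Sum>k<n.
          (if j = k then 4 * Z * (A n i j)\<^sup>2 else 0) + 2 * \<beta> * Z * (A n i j * A n i k * A n k j))"
    by (intro sum.cong) (auto simp: algebra_simps power2_eq_square)
  also have "\<dots> = 4 * Z * frob + 2 * \<beta> * Z * (\<Sum>i<n. \<Sum>j<n. \<Sum>k<n. A n i j * A n i k * A n k j)"
    by (simp add: sum.distrib sum_distrib_left)
  also have "\<dots> \<le> 4 * Z * frob + 2 * \<beta> * Z * (\<gamma> * frob)"
    using beta Z_pos by (intro add_left_mono mult_left_mono triangle_sum_le) auto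
  finally show ?thesis
    by (simp add: algebra_simps)
qed

lemma residual_nonneg: "residual x \<ge> 0"
  unfolding residual_def by (intro sum_nonneg) auto

lemma residual_tail:
  assumes "c > 0"
  shows "ising_prob A n \<beta> B (\<lambda>x. residual x > c) \<le> (4 + 2 * \<beta> * \<gamma>) * frob / c"
proof -
  have "(\<Sum>x\<in>spin_configs n. exp (F x) * residual x) / Z \<le> (4 + 2 * \<beta> * \<gamma>) * frob"
    using residual_moment Z_pos by (simp add: field_simps)
  then show ?thesis
    using ising_prob_Markov[of c residual] residual_nonneg assms
    by (meson divide_right_mono less_imp_le order_trans)
qed

lemma m_dev: "m (dev x) i = m x i - m (b x) i"
  by (simp add: m_i_def dev_def right_diff_distrib sum_subtractf)

text \<open>At \<open>b x\<close> the \<open>artanh\<close> returns the local field of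
  \<open>x\<close>, so \<open>B\<close> cancels and the gradient is \<open>- \<beta>\<close> times
  the field of \<open>dev x\<close>.\<close>

lemma grad_norm_b: "grad_norm A n \<beta> B (b x) = \<beta> * sqrt (residual x)"
proof -
  have "(\<Sum>i<n. (\<beta> * m (b x) i + B - artanh (b x i))\<^sup>2) = (\<Sum>i<n. \<beta>\<^sup>2 * (m (dev x) i)\<^sup>2)"
  proof (intro sum.cong refl)
    fix i assume "i \<in> {..<n}"
    then have "\<beta> * m (b x) i + B - artanh (b x i) = - (\<beta> * m (dev x) i)"
      by (simp add: b_eq artanh_tanh_real local_field_def m_dev algebra_simps)
    then show "(\<beta> * m (b x) i + B - artanh (b x i))\<^sup>2 = \<beta>\<^sup>2 * (m (dev x) i)\<^sup>2"
      by (simp add: power_mult_distrib)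
  qed
  then show ?thesis
    unfolding grad_norm_def residual_def using beta
    by (simp add: sum_distrib_left[symmetric] real_sqrt_mult)
qed

subsection \<open>Free energy at the conditional means\<close>

lemma sum_m_commute: "(\<Sum>i<n. x i * m y i) = (\<Sum>i<n. y i * m x i)"
proof -
  have "(\<Sum>i<n. x i * m y i) = (\<Sum>i<n. \<Sum>j<n. x i * A n i j * y j)"
    by (simp add: m_i_def sum_distrib_left mult.assoc)
  also have "\<dots> = (\<Sum>j<n. \<Sum>i<n. x i * A n i j * y j)"
    by (rule sum.swap)
  also have "\<dots> = (\<Sum>j<n. y j * m x j)"
    unfolding m_i_def sum_distrib_left by (intro sum.cong) (auto simp: symm mult_ac)
  finally show ?thesis .
qed

text \<open>Log-probability of \<open>x\<close> under independent spins with means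
  \<open>tanh (h i)\<close>; \<open>log_cosh2\<close> normalises each factor.\<close>

definition product_log_density :: "(nat \<Rightarrow> real) \<Rightarrow> (nat \<Rightarrow> real) \<Rightarrow> real" where
  "product_log_density h x = (\<Sum>i<n. x i * h i - log_cosh2 (h i))"

lemma sum_exp_product_log_density: "(\<Sum>x\<in>spin_configs n. exp (product_log_density h x)) = 1"
proof -
  have "(\<Sum>x\<in>spin_configs n. exp (product_log_density h x))
      = (\<Sum>x\<in>configs {-1, 1} {..<n} (\<lambda>_. 0). \<Prod>i<n. exp (x i * h i - log_cosh2 (h i)))"
    by (simp add: product_log_density_def exp_sum spin_configs_eq)
  also have "\<dots> = (\<Prod>i<n. \<Sum>v\<in>{-1, 1}. exp (v * h i - log_cosh2 (h i)))"
    by (subst sum_prod_configs) auto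
  also have "\<dots> = (\<Prod>i<n. 1)"
  proof (intro prod.cong refl)
    fix i
    have "exp (h i) + exp (- h i) > 0" by (simp add: add_pos_pos)
    then show "(\<Sum>v\<in>{-1, 1}. exp (v * h i - log_cosh2 (h i))) = 1"
      by (simp add: exp_diff exp_log_cosh2 add_divide_distrib[symmetric])
  qed
  finally show ?thesis by simp
qed

text \<open>Each coordinate pays once through \<open>x i * h i\<close>, as spins have modulus
  \<open>1\<close>, and once through the 1-Lipschitz \<open>log_cosh2\<close>.\<close>

lemma product_log_density_Lipschitz:
  assumes "x \<in> spin_configs n"
  shows "product_log_density h x \<le> product_log_density h' x + 2 * (\<Sum>i<n. \<bar>h i - h' i\<bar>)"
proof -
  have "x i * h i - log_cosh2 (h i) \<le> x i * h' i - log_cosh2 (h' i) + 2 * \<bar>h i - h' i\<bar>" if "i < n" for i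
  proof -
    have "x i = -1 \<or> x i = 1"
      using assms that by (auto simp: spin_configs_def)
    then show ?thesis
      using log_cosh2_Lipschitz[of "h i" "h' i"] by (auto simp: abs_if split: if_splits)
  qed
  then show ?thesis
    unfolding product_log_density_def sum_distrib_left sum.distrib[symmetric]
    by (intro sum_mono) auto
qed

text \<open>Taylor's formula for the quadratic \<open>F\<close> around \<open>x\<close>, evaluated
  at \<open>b x\<close>: the gradient is \<open>local_field x\<close>. By Legendre duality the
  linear term, \<open>local_field x\<close> paired with \<open>dev x\<close>, is the log density
  minus the entropy term.\<close>

lemma F_decomposition:
  "F x = F (b x) - I_n n (b x) + product_log_density (local_field x) x
    - \<beta> / 2 * (\<Sum>i<n. dev x i * m (dev x) i)"
proof -
  have I: "I_n n (b x) = (\<Sum>i<n. local_field x i * b x i - log_cosh2 (local_field x i))"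
    unfolding I_n_eq by (intro sum.cong) (auto simp: b_eq binary_entropy_term_tanh)
  have Q: "(\<Sum>i<n. dev x i * m (dev x) i)
      = (\<Sum>i<n. x i * m x i) + (\<Sum>i<n. b x i * m (b x) i) - 2 * (\<Sum>i<n. b x i * m x i)"
    unfolding m_dev using sum_m_commute[of x "b x"]
    by (simp add: dev_def algebra_simps sum.distrib sum_subtractf)
  have P: "product_log_density (local_field x) x - I_n n (b x)
      = \<beta> * (\<Sum>i<n. x i * m x i) - \<beta> * (\<Sum>i<n. b x i * m x i) + B * (\<Sum>i<n. x i) - B * (\<Sum>i<n. b x i)"
    unfolding I product_log_density_def local_field_def
    by (simp add: algebra_simps sum.distrib sum_subtractf sum_distrib_left)
  have "F (b x) - I_n n (b x) + product_log_density (local_field x) x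
    = F (b x) + (product_log_density (local_field x) x - I_n n (b x))"
    by simp
  then show ?thesis
    unfolding P Q F_eq by (simp add: algebra_simps)
qed

text \<open>Cauchy-Schwarz, with every deviation at most \<open>2\<close> in modulus.\<close>

lemma abs_sum_dev_le:
  assumes "x \<in> spin_configs n"
  shows "\<bar>\<Sum>i<n. dev x i * m (dev x) i\<bar> \<le> 2 * sqrt (real n) * sqrt (residual x)"
proof -
  have "\<bar>\<Sum>i<n. dev x i * m (dev x) i\<bar> \<le> (\<Sum>i<n. \<bar>dev x i\<bar> * \<bar>m (dev x) i\<bar>)"
    by (metis (no_types, lifting) abs_mult sum.cong sum_abs)
  also have "\<dots> \<le> L2_set (dev x) {..<n} * L2_set (m (dev x)) {..<n}"
    by (rule L2_set_mult_ineq)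
  also have "\<dots> \<le> (2 * sqrt (real n)) * sqrt (residual x)"
  proof (intro mult_mono)
    have "(dev x i)\<^sup>2 \<le> 2\<^sup>2" if "i < n" for i
      using power_mono[OF abs_dev_le[OF assms that], of 2] by simp
    then have "L2_set (dev x) {..<n} \<le> L2_set (\<lambda>_. 2) {..<n}"
      unfolding L2_set_def by (intro real_sqrt_le_mono sum_mono) auto
    then show "L2_set (dev x) {..<n} \<le> 2 * sqrt (real n)"
      by (simp add: L2_set_constant mult.commute)
  qed (auto simp: L2_set_def residual_def intro!: sum_nonneg)
  finally show ?thesis .
qed

lemma F_minus_I_le_ln_Z:
  assumes "\<forall>i<n. y i \<in> {-1..1}"
  shows "F y - I_n n y \<le> ln Z"
proof -
  \<comment> \<open>Coordinates beyond \<open>n\<close> are reset to \<open>0\<close> so that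
    configurations over the base point \<open>z\<close> are exactly the spin configurations.\<close>
  define z where "z i = (if i < n then y i else 0)" for i
  have "F z = F y" "I_n n z = I_n n y"
    by (simp_all add: z_def f_n_def I_n_def)
  have "exp (F z - (\<Sum>i<n. binary_entropy_term (z i))) \<le> (\<Sum>x\<in>configs {-1, 1} {..<n} z. exp (F x))"
  proof (rule gibbs_lower_bound)
    show "F y = (1 + y i) / 2 * F (y(i := 1)) + (1 - y i) / 2 * F (y(i := -1))" if "i \<in> {..<n}" for i y
      using that by (simp add: F_upd field_simps)
  qed (use assms in \<open>auto simp: z_def\<close>)
  also have "configs {-1, 1} {..<n} z = spin_configs n"
    by (auto simp: spin_configs_eq configs_def z_def)
  finally have "exp (F y - I_n n y) \<le> Z"
    using \<open>F z = F y\<close> \<open>I_n n z = I_n n y\<close> by (simp add: I_n_eq Z_eq)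
  then show ?thesis
    using Z_pos by (simp add: ln_ge_iff)
qed

lemma r_le_ln_Z: "r \<le> ln Z"
  unfolding r_n_def
  by (rule cSUP_least) (use F_minus_I_le_ln_Z in \<open>auto intro!: exI[of _ "\<lambda>_. 0"]\<close>)

text \<open>The means \<open>b x\<close> are a competitor in the supremum, which is finite by the
  bound \<open>ln Z\<close>. So the gap in (a) has a fixed sign and only one tail has to be
  estimated.\<close>

lemma F_minus_I_le_r: "F (b x) - I_n n (b x) \<le> r"
  unfolding r_n_def
proof (rule cSUP_upper)
  show "b x \<in> {y. \<forall>i<n. y i \<in> {-1..1}}"
    using tanh_real_bounds by (auto simp: b_eq less_imp_le)
  show "bdd_above ((\<lambda>y. F y - I_n n y) ` {y. \<forall>i<n. y i \<in> {-1..1}})"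
    using F_minus_I_le_ln_Z by (auto intro!: bdd_aboveI2)
qed

subsection \<open>Union bound over sparse local fields\<close>

lemma sparse_field_approximation:
  assumes x: "x \<in> spin_configs n" and \<kappa>: "0 < \<kappa>" "\<kappa> < 1" and frob: "frob \<le> \<kappa>\<^sup>2 / 4 * real n"
  shows "\<exists>y\<in>configs {-1, 0, 1} {..<n} (\<lambda>_. 0). real (card {i. i < n \<and> y i \<noteq> 0}) \<le> \<kappa> * real n
    \<and> (\<Sum>i<n. (m x i - 2 / \<kappa> * m y i)\<^sup>2) \<le> \<kappa> * real n"
proof -
  \<comment> \<open>With this \<open>p\<close> the sampling variance, at most
    \<open>frob / p\<close>, and the expected support size \<open>p * n\<close> are each at most
    \<open>\<kappa> / 2 * n\<close>.\<close>
  define p where "p = \<kappa> / 2"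
  have p: "0 < p" "p \<le> 1"
    using \<kappa> by (auto simp: p_def)
  obtain S where S: "S \<subseteq> {..<n}" and
    le: "(\<Sum>i<n. (\<Sum>j<n. ((if j \<in> S then 1 / p else 0) - 1) * (A n i j * x j))\<^sup>2) + real (card S)
      \<le> (1 / p - 1) * (\<Sum>j<n. \<Sum>i<n. (A n i j * x j)\<^sup>2) + p * real (card {..<n})"
    using sparse_approximation[OF finite_lessThan p, where I = "{..<n}" and v = "\<lambda>i j. A n i j * x j"] by blast
  have "(\<Sum>j<n. \<Sum>i<n. (A n i j * x j)\<^sup>2) = (\<Sum>j<n. \<Sum>i<n. (A n i j)\<^sup>2)"
    by (intro sum.cong refl) (simp add: power_mult_distrib spin_square[OF x])
  also have "\<dots> = frob"
    by (rule sum.swap)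
  finally have fr: "(\<Sum>j<n. \<Sum>i<n. (A n i j * x j)\<^sup>2) = frob" .
  have "(1 / p - 1) * frob \<le> 1 / p * frob"
    by (intro mult_right_mono sum_nonneg) auto
  also have "\<dots> \<le> 1 / p * (\<kappa>\<^sup>2 / 4 * real n)"
    using p frob by (intro mult_left_mono) auto
  also have "\<dots> = \<kappa> / 2 * real n"
    using \<kappa> by (simp add: p_def power2_eq_square)
  finally have total: "(\<Sum>i<n. (\<Sum>j<n. ((if j \<in> S then 1 / p else 0) - 1) * (A n i j * x j))\<^sup>2)
      + real (card S) \<le> \<kappa> * real n"
    using le unfolding fr by (simp add: p_def)
  define y where "y i = (if i \<in> S then x i else 0)" for i
  have "y \<in> configs {-1, 0, 1} {..<n} (\<lambda>_. 0)"
    using x S by (auto simp: y_def configs_def spin_configs_def)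
  moreover have "{i. i < n \<and> y i \<noteq> 0} = S"
    using x S by (fastforce simp: y_def spin_configs_def)
  moreover have "(m x i - 2 / \<kappa> * m y i)\<^sup>2
      = (\<Sum>j<n. ((if j \<in> S then 1 / p else 0) - 1) * (A n i j * x j))\<^sup>2" for i
  proof -
    have "(\<Sum>j<n. ((if j \<in> S then 1 / p else 0) - 1) * (A n i j * x j))
        = (\<Sum>j<n. 2 / \<kappa> * (A n i j * y j) - A n i j * x j)"
      by (intro sum.cong) (auto simp: y_def p_def algebra_simps)
    then have "(\<Sum>j<n. ((if j \<in> S then 1 / p else 0) - 1) * (A n i j * x j)) = - (m x i - 2 / \<kappa> * m y i)"
      by (simp add: m_i_def sum_subtractf sum_distrib_left)
    then show ?thesis
      by (simp only: power2_minus)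
  qed
  \<comment> \<open>Error and support size are both non-negative, so the bound on their sum controls
    each of them.\<close>
  moreover have "0 \<le> (\<Sum>i<n. (\<Sum>j<n. ((if j \<in> S then 1 / p else 0) - 1) * (A n i j * x j))\<^sup>2)"
    by (intro sum_nonneg) auto
  ultimately show ?thesis
    using total by (intro bexI[of _ y]) auto
qed

text \<open>In the exponent, \<open>2 * t + \<kappa> * ln (1 / t)\<close> counts the sparse vectors,
  \<open>\<beta> * \<delta>\<close> bounds the quadratic remainder,
  \<open>2 * \<beta> * sqrt \<kappa>\<close> pays for replacing the local field by a sparse one, and
  \<open>- \<epsilon>\<close> is the assumed gap.\<close>

lemma free_energy_gap_tail:
  assumes n: "n > 0" and "\<delta> > 0" and \<kappa>: "0 < \<kappa>" "\<kappa> < 1" and frob: "frob \<le> \<kappa>\<^sup>2 / 4 * real n"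
    and t: "0 < t" "t \<le> 1"
  shows "ising_prob A n \<beta> B (\<lambda>x. residual x \<le> \<delta>\<^sup>2 * real n \<and> r - (F (b x) - I_n n (b x)) > \<epsilon> * real n)
    \<le> exp ((2 * t + \<kappa> * ln (1 / t) + \<beta> * \<delta> + 2 * \<beta> * sqrt \<kappa> - \<epsilon>) * real n)"
    (is "ising_prob A n \<beta> B ?bad \<le> exp ?e")
proof -
  define Y where "Y = {y \<in> configs {-1, 0, 1 :: real} {..<n} (\<lambda>_. 0).
    real (card {i. i < n \<and> y i \<noteq> 0}) \<le> \<kappa> * real n}"
  have finY: "finite Y"
    by (simp add: Y_def finite_configs)
  define h where "h y i = \<beta> * (2 / \<kappa> * m y i) + B" for y i
  define c where "c = (\<beta> * \<delta> + 2 * \<beta> * sqrt \<kappa> - \<epsilon>) * real n"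
  have bound: "exp (F x) \<le> (\<Sum>y\<in>Y. exp (r + c) * exp (product_log_density (h y) x))"
    if x: "x \<in> spin_configs n" and bad: "?bad x" for x
  proof -
    obtain y where y: "y \<in> Y" and err: "(\<Sum>i<n. (m x i - 2 / \<kappa> * m y i)\<^sup>2) \<le> \<kappa> * real n"
      using sparse_field_approximation[OF x \<kappa> frob] unfolding Y_def by blast
    have "(\<Sum>i<n. \<bar>local_field x i - h y i\<bar>) = \<beta> * (\<Sum>i<n. \<bar>1\<bar> * \<bar>m x i - 2 / \<kappa> * m y i\<bar>)"
    proof -
      have "local_field x i - h y i = \<beta> * (m x i - 2 / \<kappa> * m y i)" for i
        by (simp add: local_field_def h_def algebra_simps)
      then show ?thesis
        using beta by (simp add: abs_mult sum_distrib_left)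
    qed
    \<comment> \<open>Cauchy-Schwarz against the constant \<open>1\<close> turns the mean-square
      error into the absolute error needed for the log density.\<close>
    also have "\<dots> \<le> \<beta> * (L2_set (\<lambda>_. 1) {..<n} * L2_set (\<lambda>i. m x i - 2 / \<kappa> * m y i) {..<n})"
      using beta by (intro mult_left_mono L2_set_mult_ineq) auto
    also have "\<dots> \<le> \<beta> * (sqrt (real n) * sqrt (\<kappa> * real n))"
      using beta err by (intro mult_left_mono mult_mono) (auto simp: L2_set_def intro!: sum_nonneg)
    also have "\<dots> = \<beta> * sqrt \<kappa> * real n"
      by (simp add: real_sqrt_mult)
    finally have fields: "(\<Sum>i<n. \<bar>local_field x i - h y i\<bar>) \<le> \<beta> * sqrt \<kappa> * real n" .
    have "sqrt (residual x) \<le> sqrt (\<delta>\<^sup>2 * real n)"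
      using bad by simp
    then have "2 * sqrt (real n) * sqrt (residual x) \<le> 2 * sqrt (real n) * (\<delta> * sqrt (real n))"
      using assms(2) by (intro mult_left_mono) (auto simp: real_sqrt_mult)
    then have "- (\<Sum>i<n. dev x i * m (dev x) i) \<le> 2 * \<delta> * real n"
      using abs_sum_dev_le[OF x] by (simp add: mult_ac)
    then have "\<beta> / 2 * (- (\<Sum>i<n. dev x i * m (dev x) i)) \<le> \<beta> / 2 * (2 * \<delta> * real n)"
      using beta by (intro mult_left_mono) auto
    then have "F x \<le> r + c + product_log_density (h y) x"
      using F_decomposition[of x] product_log_density_Lipschitz[OF x, of "local_field x" "h y"] fields bad
      by (simp add: c_def algebra_simps)
    then have "exp (F x) \<le> exp (r + c) * exp (product_log_density (h y) x)"
      by (simp add: exp_add[symmetric])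
    also have "\<dots> \<le> (\<Sum>y\<in>Y. exp (r + c) * exp (product_log_density (h y) x))"
      using y finY by (intro member_le_sum) auto
    finally show ?thesis .
  qed
  have "(\<Sum>x\<in>{x\<in>spin_configs n. ?bad x}. exp (F x))
      \<le> (\<Sum>x\<in>{x\<in>spin_configs n. ?bad x}. \<Sum>y\<in>Y. exp (r + c) * exp (product_log_density (h y) x))"
    using bound by (intro sum_mono) auto
  also have "\<dots> \<le> (\<Sum>x\<in>spin_configs n. \<Sum>y\<in>Y. exp (r + c) * exp (product_log_density (h y) x))"
    by (intro sum_mono2) (auto intro!: sum_nonneg)
  \<comment> \<open>Summing over \<open>x\<close> first, every product measure has total mass
    \<open>1\<close>, so only the number of sparse vectors remains.\<close>
  also have "\<dots> = (\<Sum>y\<in>Y. \<Sum>x\<in>spin_configs n. exp (r + c) * exp (product_log_density (h y) x))"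
    by (rule sum.swap)
  also have "\<dots> = real (card Y) * exp (r + c)"
    by (simp add: sum_distrib_left[symmetric] sum_exp_product_log_density)
  also have "\<dots> \<le> exp (2 * t * real n + \<kappa> * real n * ln (1 / t)) * exp (r + c)"
    unfolding Y_def by (intro mult_right_mono card_sparse_sign_vectors t) auto
  also have "\<dots> = exp ?e * exp r"
    by (simp add: mult_exp_exp c_def algebra_simps)
  \<comment> \<open>The Gibbs lower bound on \<open>Z\<close> absorbs \<open>exp r\<close> into the
    normalising constant.\<close>
  also have "\<dots> \<le> exp ?e * Z"
    using r_le_ln_Z Z_pos by (intro mult_left_mono) (auto simp: ln_ge_iff)
  finally show ?thesis
    unfolding ising_prob_eq using Z_pos by (simp add: divide_le_eq)
qed

end

section \<open>Passage to the limit\<close>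

theorem theorem6:
  fixes A :: "nat \<Rightarrow> nat \<Rightarrow> nat \<Rightarrow> real" and \<beta> B :: real
  assumes symm: "\<And>n i j. i < n \<Longrightarrow> j < n \<Longrightarrow> A n i j = A n j i"
    and nonneg: "\<And>n i j. i < n \<Longrightarrow> j < n \<Longrightarrow> A n i j \<ge> 0"
    and diag: "\<And>n i. i < n \<Longrightarrow> A n i i = 0"
    and C1: "\<exists>\<gamma>. \<forall>n i. i < n \<longrightarrow> (\<Sum>j<n. A n i j) \<le> \<gamma>"
    and mean_field: "(\<lambda>n. (\<Sum>i<n. \<Sum>j<n. (A n i j)\<^sup>2) / real n) \<longlonglongrightarrow> 0"
    and beta: "\<beta> > 0" and Bne: "B \<noteq> 0"
  shows "(\<forall>\<epsilon>>0. (\<lambda>n. ising_prob A n \<beta> B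
            (\<lambda>x. \<bar>f_n A n \<beta> B (b_vec A n \<beta> B x) - I_n n (b_vec A n \<beta> B x) - r_n A n \<beta> B\<bar> / real n > \<epsilon>))
          \<longlonglongrightarrow> 0)
       \<and> (\<forall>\<epsilon>>0. (\<lambda>n. ising_prob A n \<beta> B
            (\<lambda>x. grad_norm A n \<beta> B (b_vec A n \<beta> B x) / sqrt (real n) > \<epsilon>))
          \<longlonglongrightarrow> 0)"
proof -
  obtain \<gamma> where \<gamma>: "\<And>n i. i < n \<Longrightarrow> (\<Sum>j<n. A n i j) \<le> \<gamma>"
    using C1 by blast
  have ising: "ising A n \<beta> (max \<gamma> 0)" for n
    by unfold_locales (use symm nonneg diag \<gamma> beta in \<open>auto intro: max.coboundedI1\<close>)
  define s where "s n = (\<Sum>i<n. \<Sum>j<n. (A n i j)\<^sup>2) / real n" for n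
  have s: "s \<longlonglongrightarrow> 0"
    using mean_field by (simp add: s_def[abs_def])
  define C where "C = 4 + 2 * \<beta> * max \<gamma> 0"
  have tail: "ising_prob A n \<beta> B (\<lambda>x. ising.residual A n \<beta> B x > \<delta> * real n) \<le> C / \<delta> * s n"
    if "\<delta> > 0" "n > 0" for n \<delta>
    using ising.residual_tail[OF ising, of "\<delta> * real n" n B] that
    by (simp add: C_def s_def field_simps)
  show ?thesis
  proof (intro conjI allI impI)
    fix \<epsilon> :: real assume \<epsilon>: "\<epsilon> > 0"
    \<comment> \<open>The terms \<open>\<beta> * \<delta>\<close>, \<open>2 * t\<close> and those in
      \<open>\<kappa>\<close> each get a budget of \<open>\<epsilon> / 8\<close>, so the exponent
      stays below \<open>- \<epsilon> / 2\<close> per site.\<close>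
    define \<delta> where "\<delta> = \<epsilon> / (8 * \<beta>)"
    define t where "t = min 1 (\<epsilon> / 16)"
    have \<delta>: "\<delta> > 0" and t: "0 < t" "t \<le> 1" "2 * t \<le> \<epsilon> / 8"
      using \<epsilon> beta by (auto simp: \<delta>_def t_def)
    \<comment> \<open>As \<open>t\<close> is already fixed, \<open>ln (1 / t)\<close> is a constant
      and both terms vanish as \<open>\<kappa>\<close> decreases to \<open>0\<close>.\<close>
    have "((\<lambda>\<kappa>. \<kappa> * ln (1 / t) + 2 * \<beta> * sqrt \<kappa>) \<longlongrightarrow> 0 * ln (1 / t) + 2 * \<beta> * sqrt 0) (at_right 0)"
      by (intro tendsto_intros)
    then have "eventually (\<lambda>\<kappa>. \<kappa> * ln (1 / t) + 2 * \<beta> * sqrt \<kappa> < \<epsilon> / 8) (at_right 0)"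
      using \<epsilon> by (intro order_tendstoD) auto
    moreover have "eventually (\<lambda>\<kappa>. \<kappa> \<in> {0<..<1}) (at_right (0::real))"
      by (rule eventually_at_right_real) simp
    ultimately have "eventually (\<lambda>\<kappa>. \<kappa> * ln (1 / t) + 2 * \<beta> * sqrt \<kappa> < \<epsilon> / 8 \<and> \<kappa> \<in> {0<..<1}) (at_right 0)"
      by (rule eventually_conj)
    from eventually_happens'[OF _ this] obtain \<kappa> where \<kappa>: "0 < \<kappa>" "\<kappa> < 1" and small: "\<kappa> * ln (1 / t) + 2 * \<beta> * sqrt \<kappa> < \<epsilon> / 8"
      by auto
    have bound: "ising_prob A n \<beta> B
          (\<lambda>x. \<bar>f_n A n \<beta> B (b_vec A n \<beta> B x) - I_n n (b_vec A n \<beta> B x) - r_n A n \<beta> B\<bar> / real n > \<epsilon>)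
        \<le> C / \<delta>\<^sup>2 * s n + exp (- (\<epsilon> / 2)) ^ n"
      if n: "n > 0" and sn: "s n < \<kappa>\<^sup>2 / 4" for n
    proof -
      interpret ising A n \<beta> B "max \<gamma> 0" by (rule ising)
      let ?gap = "\<lambda>x. r - (F (b x) - I_n n (b x)) > \<epsilon> * real n"
      \<comment> \<open>A bad configuration has either a large residual, controlled by its
        expectation, or a small residual and a large gap, controlled by the union bound.\<close>
      have "ising_prob A n \<beta> B (\<lambda>x. \<bar>F (b x) - I_n n (b x) - r\<bar> / real n > \<epsilon>)
          \<le> ising_prob A n \<beta> B (\<lambda>x. residual x > \<delta>\<^sup>2 * real n \<or> (residual x \<le> \<delta>\<^sup>2 * real n \<and> ?gap x))"
      proof (rule ising_prob_mono)
        fix x assume "\<bar>F (b x) - I_n n (b x) - r\<bar> / real n > \<epsilon>"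
        then have "?gap x"
          using F_minus_I_le_r[of x] n by (simp add: field_simps)
        then show "residual x > \<delta>\<^sup>2 * real n \<or> (residual x \<le> \<delta>\<^sup>2 * real n \<and> ?gap x)"
          by linarith
      qed
      also have "\<dots> \<le> ising_prob A n \<beta> B (\<lambda>x. residual x > \<delta>\<^sup>2 * real n)
          + ising_prob A n \<beta> B (\<lambda>x. residual x \<le> \<delta>\<^sup>2 * real n \<and> ?gap x)"
        by (rule ising_prob_disj)
      also have "\<dots> \<le> C / \<delta>\<^sup>2 * s n + exp (- (\<epsilon> / 2)) ^ n"
      proof (intro add_mono)
        show "ising_prob A n \<beta> B (\<lambda>x. residual x > \<delta>\<^sup>2 * real n) \<le> C / \<delta>\<^sup>2 * s n"
          using tail[of "\<delta>\<^sup>2" n] \<delta> n by simp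
        have "frob \<le> \<kappa>\<^sup>2 / 4 * real n"
          using sn n by (simp add: s_def field_simps)
        then have "ising_prob A n \<beta> B (\<lambda>x. residual x \<le> \<delta>\<^sup>2 * real n \<and> ?gap x)
            \<le> exp ((2 * t + \<kappa> * ln (1 / t) + \<beta> * \<delta> + 2 * \<beta> * sqrt \<kappa> - \<epsilon>) * real n)"
          by (intro free_energy_gap_tail n \<delta> \<kappa> t)
        also have "\<dots> \<le> exp (- (\<epsilon> / 2) * real n)"
        proof -
          have "\<beta> * \<delta> = \<epsilon> / 8"
            using beta by (simp add: \<delta>_def)
          then have "2 * t + \<kappa> * ln (1 / t) + \<beta> * \<delta> + 2 * \<beta> * sqrt \<kappa> - \<epsilon> \<le> - (\<epsilon> / 2)"
            using t small \<epsilon> by linarith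
          then have "(2 * t + \<kappa> * ln (1 / t) + \<beta> * \<delta> + 2 * \<beta> * sqrt \<kappa> - \<epsilon>) * real n \<le> - (\<epsilon> / 2) * real n"
            by (rule mult_right_mono) simp
          then show ?thesis by simp
        qed
        also have "\<dots> = exp (- (\<epsilon> / 2)) ^ n"
          by (simp add: exp_of_nat_mult[symmetric] mult.commute)
        finally show "ising_prob A n \<beta> B (\<lambda>x. residual x \<le> \<delta>\<^sup>2 * real n \<and> ?gap x) \<le> exp (- (\<epsilon> / 2)) ^ n" .
      qed
      finally show ?thesis .
    qed
    have "(\<lambda>n. C / \<delta>\<^sup>2 * s n + exp (- (\<epsilon> / 2)) ^ n) \<longlonglongrightarrow> C / \<delta>\<^sup>2 * 0 + 0"
      using \<epsilon> by (intro tendsto_intros s LIMSEQ_power_zero) auto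
    then have lim: "(\<lambda>n. C / \<delta>\<^sup>2 * s n + exp (- (\<epsilon> / 2)) ^ n) \<longlonglongrightarrow> 0"
      by simp
    have ev: "eventually (\<lambda>n. s n < \<kappa>\<^sup>2 / 4) sequentially"
      using s \<kappa> by (intro order_tendstoD) auto
    show "(\<lambda>n. ising_prob A n \<beta> B
            (\<lambda>x. \<bar>f_n A n \<beta> B (b_vec A n \<beta> B x) - I_n n (b_vec A n \<beta> B x) - r_n A n \<beta> B\<bar> / real n > \<epsilon>))
          \<longlonglongrightarrow> 0"
    proof (rule tendsto_sandwich[OF _ _ tendsto_const lim])
      show "eventually (\<lambda>n. ising_prob A n \<beta> B
            (\<lambda>x. \<bar>f_n A n \<beta> B (b_vec A n \<beta> B x) - I_n n (b_vec A n \<beta> B x) - r_n A n \<beta> B\<bar> / real n > \<epsilon>)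
          \<le> C / \<delta>\<^sup>2 * s n + exp (- (\<epsilon> / 2)) ^ n) sequentially"
        using eventually_gt_at_top[of 0] ev by eventually_elim (rule bound)
    qed (intro always_eventually allI ising.ising_prob_nonneg[OF ising])
  next
    fix \<epsilon> :: real assume \<epsilon>: "\<epsilon> > 0"
    \<comment> \<open>The gradient norm is \<open>\<beta> * sqrt (residual x)\<close>, so it exceeds
      \<open>\<epsilon> * sqrt n\<close> only if the residual exceeds
      \<open>\<delta> * n\<close>.\<close>
    define \<delta> where "\<delta> = (\<epsilon> / \<beta>)\<^sup>2"
    have \<delta>: "\<delta> > 0"
      using \<epsilon> beta by (simp add: \<delta>_def)
    have bound: "ising_prob A n \<beta> B (\<lambda>x. grad_norm A n \<beta> B (b_vec A n \<beta> B x) / sqrt (real n) > \<epsilon>)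
        \<le> C / \<delta> * s n" if n: "n > 0" for n
    proof -
      interpret ising A n \<beta> B "max \<gamma> 0" by (rule ising)
      have "ising_prob A n \<beta> B (\<lambda>x. grad_norm A n \<beta> B (b x) / sqrt (real n) > \<epsilon>)
          \<le> ising_prob A n \<beta> B (\<lambda>x. residual x > \<delta> * real n)"
      proof (rule ising_prob_mono)
        fix x assume "grad_norm A n \<beta> B (b x) / sqrt (real n) > \<epsilon>"
        then have "\<epsilon> / \<beta> * sqrt (real n) < sqrt (residual x)"
          using n beta by (simp add: grad_norm_b field_simps)
        then have "(\<epsilon> / \<beta> * sqrt (real n))\<^sup>2 < (sqrt (residual x))\<^sup>2"
          using \<epsilon> beta by (intro power_strict_mono) auto
        then show "residual x > \<delta> * real n"
          using residual_nonneg[of x] by (simp add: \<delta>_def power_mult_distrib power_divide)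
      qed
      then show ?thesis
        using tail[OF \<delta> n] by simp
    qed
    have lim: "(\<lambda>n. C / \<delta> * s n) \<longlonglongrightarrow> 0"
      using tendsto_mult_left[OF s, of "C / \<delta>"] by simp
    show "(\<lambda>n. ising_prob A n \<beta> B (\<lambda>x. grad_norm A n \<beta> B (b_vec A n \<beta> B x) / sqrt (real n) > \<epsilon>))
          \<longlonglongrightarrow> 0"
    proof (rule tendsto_sandwich[OF _ _ tendsto_const lim])
      show "eventually (\<lambda>n. ising_prob A n \<beta> B
            (\<lambda>x. grad_norm A n \<beta> B (b_vec A n \<beta> B x) / sqrt (real n) > \<epsilon>) \<le> C / \<delta> * s n) sequentially"
        using eventually_gt_at_top[of 0] by eventually_elim (rule bound)
    qed (intro always_eventually allI ising.ising_prob_nonneg[OF ising])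
  qed
qed

end
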